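(* For each integer $n\ge 2$, the map $Q_n\to\mathbf{R}$, $f\mapsto\lim_{m\to\infty}\frac{0\cdot f^m}{m}$, is a nontrivial (i.e. not identically zero) homogeneous quasimorphism on $Q_n=[\Gamma_n,\Gamma_n]$. It follows that $Q_n$ has infinite commutator width: for each $m\in\mathbf{N}$ there is an $f\in Q_n$ which cannot be expressed as a product of fewer than $m$ commutators of elements of $Q_n$.
   Context: All actions are right actions: $x\cdot f$ is the image of $x$ under $f$, and $x\cdot f'$ is the derivative of $f$ at $x$. $\mathrm{Homeo}^+(\mathbf{R})$ is the group of orientation-preserving homeomorphisms of $\mathbf{R}$. A piecewise linear homeomorphism is one that is affine on each component of the complement of a closed discrete set; a breakpoint is a point where left and right derivatives differ. For $n\ge 2$, $\Gamma_n\leq\mathrm{Homeo}^+(\mathbf{R})$ is the group of all $f\in\mathrm{Homeo}^+(\mathbf{R})$ such that: (1) $f$ is piecewise linear with breakpoints in $\mathbf{Z}[\frac{1}{n(n+1)}]$, and $\mathbf{Z}[\frac1{n(n+1)}]\cdot f=\mathbf{Z}[\frac{1}{n(n+1)}]$; (2) $f$ commutes with the translation $t\mapsto t+1$; (3) for each $x\in\mathbf{R}\setminus\mathbf{Z}[\frac{1}{n(n+1)}]$ there exist (unique) $i,j\in\mathbf{Z}$ such that $x\cdot f'=n^i(n+1)^j$, and $i-j=|\mathbf{Z}\cap(x,x\cdot f)|$ if $x\le x\cdot f$, while $i-j=-|\mathbf{Z}\cap(x\cdot f,x)|$ if $x>x\cdot f$. A quasimorphism on a group $G$ is a map $q:G\to\mathbf{R}$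 with $\sup_{g,h\in G}|q(gh)-q(g)-q(h)|<\infty$; it is homogeneous if $q(g^k)=kq(g)$ for all $g\in G$, $k\in\mathbf{Z}$. *)

theory Defs
  imports "HOL-Analysis.Analysis" "HOL-Algebra.Generated_Groups"
begin

text \<open>Actions are right actions: the image of \<open>x\<close> under the product \<open>f \<otimes> g\<close> is \<open>g (f x)\<close>.\<close>

definition Homeo_plus :: "(real \<Rightarrow> real) monoid" where
  "Homeo_plus =
     \<lparr> carrier = {f. (\<exists>g. homeomorphism UNIV UNIV f g) \<and> strict_mono f},
       mult = (\<lambda>f g. g \<circ> f),
       one = id \<rparr>"

lemma group_Homeo_plus: "group Homeo_plus"
proof (rule groupI)
  fix f h assume "f \<in> carrier Homeo_plus" "h \<in> carrier Homeo_plus"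
  then obtain f' h' where "homeomorphism UNIV UNIV f f'" "homeomorphism UNIV UNIV h h'"
    "strict_mono f" "strict_mono h"
    by (auto simp: Homeo_plus_def)
  then show "f \<otimes>\<^bsub>Homeo_plus\<^esub> h \<in> carrier Homeo_plus"
    by (auto simp: Homeo_plus_def strict_mono_def intro: homeomorphism_compose)
next
  show "\<one>\<^bsub>Homeo_plus\<^esub> \<in> carrier Homeo_plus"
    by (auto simp: Homeo_plus_def strict_mono_def id_def intro: homeomorphism_ident)
next
  fix f assume "f \<in> carrier Homeo_plus"
  then obtain g where g: "homeomorphism UNIV UNIV f g" and f: "strict_mono f"
    by (auto simp: Homeo_plus_def)
  have fg: "f (g y) = y" for y
    using g by (simp add: homeomorphism_def)
  have "strict_mono g"
  proof (rule strict_monoI)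
    fix x y :: real assume "x < y"
    then show "g x < g y"
      using f fg by (metis strict_mono_less)
  qed
  then have "g \<in> carrier Homeo_plus"
    using homeomorphism_symD[OF g] by (auto simp: Homeo_plus_def)
  moreover have "g \<otimes>\<^bsub>Homeo_plus\<^esub> f = \<one>\<^bsub>Homeo_plus\<^esub>"
    using fg by (auto simp: Homeo_plus_def)
  ultimately show "\<exists>g\<in>carrier Homeo_plus. g \<otimes>\<^bsub>Homeo_plus\<^esub> f = \<one>\<^bsub>Homeo_plus\<^esub>"
    by blast
qed (auto simp: Homeo_plus_def comp_assoc)

text \<open>The subring \<open>\<int>[1/m]\<close> of \<open>\<real>\<close>.\<close>

definition Z_inv :: "nat \<Rightarrow> real set" where
  "Z_inv m = {of_int a / real m ^ k | a k. True}"

definition piecewise_linear :: "(real \<Rightarrow> real) \<Rightarrow> bool" where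
  "piecewise_linear f \<longleftrightarrow>
     (\<exists>S. closed S \<and> discrete S \<and>
        (\<forall>C\<in>components (- S). \<exists>a b. \<forall>x\<in>C. f x = a * x + b))"

definition breakpoint :: "(real \<Rightarrow> real) \<Rightarrow> real \<Rightarrow> bool" where
  "breakpoint f x \<longleftrightarrow>
     (\<exists>l r. (f has_real_derivative l) (at_left x) \<and>
            (f has_real_derivative r) (at_right x) \<and> l \<noteq> r)"

definition Gamma :: "nat \<Rightarrow> (real \<Rightarrow> real) set" where
  "Gamma n =
     {f \<in> carrier Homeo_plus.
        piecewise_linear f \<and>
        (\<forall>x. breakpoint f x \<longrightarrow> x \<in> Z_inv (n * (n + 1))) \<and>
        f ` Z_inv (n * (n + 1)) = Z_inv (n * (n + 1)) \<and>
        (\<forall>t. f (t + 1) = f t + 1) \<and>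
        (\<forall>x. x \<notin> Z_inv (n * (n + 1)) \<longrightarrow>
           (\<exists>i j :: int.
              (f has_real_derivative (real n powi i * real (n + 1) powi j)) (at x) \<and>
              (x \<le> f x \<longrightarrow> i - j = int (card (\<int> \<inter> {x<..<f x}))) \<and>
              (f x < x \<longrightarrow> i - j = - int (card (\<int> \<inter> {f x<..<x})))))}"

text \<open>The commutator subgroup of \<open>Gamma n\<close>, as a group in its own right; the commutators
  are formed with the operations of the ambient group.\<close>

definition Q :: "nat \<Rightarrow> (real \<Rightarrow> real) monoid" where
  "Q n = Homeo_plus \<lparr> carrier := derived Homeo_plus (Gamma n) \<rparr>"

lemma group_Q: "group (Q n)"
proof -
  interpret group Homeo_plus by (rule group_Homeo_plus)
  have "Gamma n \<subseteq> carrier Homeo_plus"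
    by (auto simp: Gamma_def)
  then show ?thesis
    unfolding Q_def by (intro subgroup_imp_group derived_is_subgroup)
qed

definition quasimorphism :: "('a, 'b) monoid_scheme \<Rightarrow> ('a \<Rightarrow> real) \<Rightarrow> bool" where
  "quasimorphism G q \<longleftrightarrow>
     bdd_above ((\<lambda>(g, h). \<bar>q (g \<otimes>\<^bsub>G\<^esub> h) - q g - q h\<bar>) ` (carrier G \<times> carrier G))"

definition homogeneous_on :: "('a, 'b) monoid_scheme \<Rightarrow> ('a \<Rightarrow> real) \<Rightarrow> bool" where
  "homogeneous_on G q \<longleftrightarrow> (\<forall>g\<in>carrier G. \<forall>k::int. q (g [^]\<^bsub>G\<^esub> k) = of_int k * q g)"

definition translation_number :: "(real \<Rightarrow> real) \<Rightarrow> real" where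
  "translation_number f = lim (\<lambda>m. (f ^^ m) 0 / real m)"

text \<open>\<open>derived_set G (carrier G)\<close> is the set of all commutators of elements of \<open>G\<close>.\<close>

definition product_of_commutators :: "('a, 'b) monoid_scheme \<Rightarrow> nat \<Rightarrow> 'a \<Rightarrow> bool" where
  "product_of_commutators G k g \<longleftrightarrow>
     (\<exists>cs. length cs = k \<and> set cs \<subseteq> derived_set G (carrier G) \<and>
           g = foldr (\<otimes>\<^bsub>G\<^esub>) cs \<one>\<^bsub>G\<^esub>)"

end

theory Submission
  imports Defs
begin

text \<open>
  Every element of \<open>Q n\<close> is a lift of a circle homeomorphism, so the quasimorphism property,
  homogeneity and convergence are Poincare's classical facts: the displacement of a lift varies by
  at most \<open>1\<close>, hence \<open>m \<mapsto> (f ^^ m) 0\<close> is additive up to \<open>1\<close>. Unbounded commutator width then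
  follows because a homogeneous quasimorphism is bounded on products of \<open>k\<close> commutators
  (\<open>unbounded_commutator_width\<close>) but unbounded on the powers of an element where it does not vanish.

  The real content is an element of the \<^emph>\<open>commutator subgroup\<close> with nonzero translation number. Take
  \<open>h\<close> and \<open>g\<close> in \<open>Gamma n\<close> such that \<open>h\<close> fixes every integer and pushes all other points to the
  right (\<open>pushing_element\<close>), while \<open>g\<close> moves the integers off the integers
  (\<open>element_moving_integers_off_integers\<close>). The conjugate \<open>k\<close> of \<open>h\<close> by \<open>g\<close> pushes everything to the
  right except the points of \<open>g ` \<int>\<close>, so \<open>X = h k\<close> moves every point to the right and the orbit of
  \<open>0\<close> under \<open>X\<close> tends to infinity. In the abelianization \<open>h\<close> and \<open>k\<close> coincide, so
  \<open>f = (inv h)^(2m) X^m\<close> lies in the commutator subgroup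
  (\<open>conjugate_product_power_in_derived\<close>). As \<open>h\<close> fixes \<open>0\<close>, the map \<open>f\<close> sends \<open>0\<close> to
  \<open>(X ^^ m) 0\<close>, which is at least \<open>2\<close> for suitable \<open>m\<close>; since the translation number differs from
  the displacement of \<open>0\<close> by at most \<open>1\<close>, it is at least \<open>1\<close> for \<open>f\<close>.

  The argument conjugates by products of \<open>g\<close> and \<open>h\<close>, so it needs a group containing both. It is run
  in \<open>germ_group n\<close>, a subset of \<open>Gamma n\<close> described by one-sided affine germs, for which closure
  under composition and inversion is a pointwise computation.
\<close>

section \<open>Homogeneous quasimorphisms and commutator width\<close>

lemma quasimorphismD:
  assumes "quasimorphism G q"
  obtains D where
    "\<And>g h. g \<in> carrier G \<Longrightarrow> h \<in> carrier G \<Longrightarrow> \<bar>q (g \<otimes>\<^bsub>G\<^esub> h) - q g - q h\<bar> \<le> D"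
  using assms unfolding quasimorphism_def bdd_above_def by fastforce

lemma homogeneous_inv:
  assumes "group G" "homogeneous_on G q" "g \<in> carrier G"
  shows "q (inv\<^bsub>G\<^esub> g) = - q g"
proof -
  interpret group G by fact
  have "q (g [^]\<^bsub>G\<^esub> (-1::int)) = of_int (-1) * q g"
    using assms unfolding homogeneous_on_def by blast
  then show ?thesis
    using assms(3) by (simp add: int_pow_neg)
qed

text \<open>A commutator has value at most \<open>3 D\<close> when \<open>D\<close> bounds the defect, because the values of its four
  factors cancel; so a product of \<open>k\<close> commutators has value at most \<open>4 D k\<close>, whereas the value of the
  \<open>M\<close>-th power of \<open>g\<close> grows linearly in \<open>M\<close>.\<close>

lemma unbounded_commutator_width:
  assumes G: "group G" and q: "quasimorphism G q" and hom: "homogeneous_on G q"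
    and g: "g \<in> carrier G" "q g \<noteq> 0"
  shows "\<exists>f\<in>carrier G. \<not> (\<exists>k<m. product_of_commutators G k f)"
proof -
  interpret group G by fact
  obtain D where D: "\<And>a b. a \<in> carrier G \<Longrightarrow> b \<in> carrier G \<Longrightarrow> \<bar>q (a \<otimes>\<^bsub>G\<^esub> b) - q a - q b\<bar> \<le> D"
    using quasimorphismD[OF q] by blast
  have D0: "D \<ge> 0"
    using D[OF g(1) g(1)] by linarith
  have q_one: "q \<one>\<^bsub>G\<^esub> = 0"
    using homogeneous_inv[OF G hom, of "\<one>\<^bsub>G\<^esub>"] by simp
  have comm: "c \<in> carrier G \<and> \<bar>q c\<bar> \<le> 3 * D" if mem: "c \<in> derived_set G (carrier G)" for c
  proof -
    obtain a b where ab: "a \<in> carrier G" "b \<in> carrier G"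
      and c: "c = a \<otimes>\<^bsub>G\<^esub> b \<otimes>\<^bsub>G\<^esub> inv\<^bsub>G\<^esub> a \<otimes>\<^bsub>G\<^esub> inv\<^bsub>G\<^esub> b"
      using mem by blast
    have "\<bar>q (a \<otimes>\<^bsub>G\<^esub> b) - q a - q b\<bar> \<le> D"
      "\<bar>q (a \<otimes>\<^bsub>G\<^esub> b \<otimes>\<^bsub>G\<^esub> inv\<^bsub>G\<^esub> a) - q (a \<otimes>\<^bsub>G\<^esub> b) - q (inv\<^bsub>G\<^esub> a)\<bar> \<le> D"
      "\<bar>q c - q (a \<otimes>\<^bsub>G\<^esub> b \<otimes>\<^bsub>G\<^esub> inv\<^bsub>G\<^esub> a) - q (inv\<^bsub>G\<^esub> b)\<bar> \<le> D"
      unfolding c using ab by (auto intro!: D)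
    then show ?thesis
      using homogeneous_inv[OF G hom] ab c by (auto simp: abs_le_iff)
  qed
  have prod: "foldr (\<otimes>\<^bsub>G\<^esub>) cs \<one>\<^bsub>G\<^esub> \<in> carrier G \<and>
      \<bar>q (foldr (\<otimes>\<^bsub>G\<^esub>) cs \<one>\<^bsub>G\<^esub>)\<bar> \<le> real (length cs) * (4 * D)"
    if "set cs \<subseteq> derived_set G (carrier G)" for cs
    using that
  proof (induction cs)
    case Nil
    then show ?case by (simp add: q_one)
  next
    case (Cons c cs)
    define p where "p = foldr (\<otimes>\<^bsub>G\<^esub>) cs \<one>\<^bsub>G\<^esub>"
    have p: "p \<in> carrier G" "\<bar>q p\<bar> \<le> real (length cs) * (4 * D)"
      using Cons unfolding p_def by auto
    have c: "c \<in> carrier G" "\<bar>q c\<bar> \<le> 3 * D"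
      using comm[of c] Cons.prems by auto
    have "\<bar>q (c \<otimes>\<^bsub>G\<^esub> p)\<bar> \<le> real (length cs) * (4 * D) + 4 * D"
      using D[OF c(1) p(1)] p(2) c(2) by linarith
    then show ?case
      using c(1) p(1) by (simp add: p_def[symmetric] algebra_simps)
  qed
  obtain M :: nat where M: "real m * (4 * D) < real M * \<bar>q g\<bar>"
    using reals_Archimedean3[of "\<bar>q g\<bar>"] g(2) by auto
  have "\<not> product_of_commutators G k (g [^]\<^bsub>G\<^esub> M)" if "k < m" for k
  proof
    assume "product_of_commutators G k (g [^]\<^bsub>G\<^esub> M)"
    then obtain cs where "length cs = k" "set cs \<subseteq> derived_set G (carrier G)"
        "g [^]\<^bsub>G\<^esub> M = foldr (\<otimes>\<^bsub>G\<^esub>) cs \<one>\<^bsub>G\<^esub>"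
      unfolding product_of_commutators_def by blast
    then have "\<bar>q (g [^]\<^bsub>G\<^esub> M)\<bar> \<le> real k * (4 * D)"
      using prod[of cs] by simp
    also have "\<dots> \<le> real m * (4 * D)"
      using that D0 by (intro mult_right_mono) auto
    finally have "\<bar>q (g [^]\<^bsub>G\<^esub> M)\<bar> < real M * \<bar>q g\<bar>"
      using M by linarith
    moreover have "q (g [^]\<^bsub>G\<^esub> int M) = real M * q g"
      using hom g(1) unfolding homogeneous_on_def by auto
    ultimately show False
      by (simp add: int_pow_int abs_mult)
  qed
  then show ?thesis
    using g(1) by blast
qed

section \<open>The translation number\<close>

definition circle_lift :: "(real \<Rightarrow> real) \<Rightarrow> bool" where
  "circle_lift f \<longleftrightarrow> mono f \<and> (\<forall>t. f (t + 1) = f t + 1)"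

lemma circle_lift_comp: "circle_lift f \<Longrightarrow> circle_lift g \<Longrightarrow> circle_lift (g \<circ> f)"
  by (auto simp: circle_lift_def mono_def)

lemma circle_lift_funpow: "circle_lift f \<Longrightarrow> circle_lift (f ^^ m)"
  by (induction m) (auto simp: circle_lift_comp circle_lift_def mono_def)

lemma commute_add_int:
  fixes f :: "real \<Rightarrow> real"
  assumes "\<And>t. f (t + 1) = f t + 1"
  shows "f (t + of_int k) = f t + of_int k"
proof (induction k rule: int_induct[of _ 0])
  case (step1 i)
  then show ?case using assms[of "t + of_int i"] by (simp add: add.assoc)
next
  case (step2 i)
  then show ?case using assms[of "t + of_int (i - 1)"] by (simp add: algebra_simps)
qed simp

text \<open>Both \<open>x\<close> and \<open>f x\<close> can be compared with the integer \<open>\<lfloor>x\<rfloor>\<close>, where the displacement is exactly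
  \<open>f 0\<close>.\<close>

lemma circle_lift_add_bound:
  assumes "circle_lift f"
  shows "\<bar>f x - x - f 0\<bar> \<le> 1"
proof -
  have f: "f (t + of_int k) = f t + of_int k" for t k
    using commute_add_int assms unfolding circle_lift_def by blast
  have m: "mono f"
    using assms by (simp add: circle_lift_def)
  have "f (of_int \<lfloor>x\<rfloor>) \<le> f x" "f x \<le> f (of_int \<lfloor>x\<rfloor> + 1)"
    by (auto intro!: monoD[OF m])
  then have "f 0 + of_int \<lfloor>x\<rfloor> \<le> f x" "f x \<le> f 0 + of_int \<lfloor>x\<rfloor> + 1"
    using f[of 0 "\<lfloor>x\<rfloor>"] f[of 0 "\<lfloor>x\<rfloor> + 1"] by auto
  then show ?thesis
    by linarith
qed

lemma circle_lift_funpow_mult_bound: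
  assumes "circle_lift f"
  shows "\<bar>(f ^^ (m * k)) 0 - real m * (f ^^ k) 0\<bar> \<le> real m"
proof (induction m)
  case (Suc m)
  have "(f ^^ (Suc m * k)) 0 = (f ^^ k) ((f ^^ (m * k)) 0)"
    by (simp add: funpow_add)
  then show ?case
    using circle_lift_add_bound[OF circle_lift_funpow[OF assms, of k], of "(f ^^ (m * k)) 0"] Suc
    by (simp add: algebra_simps)
qed simp

text \<open>Both ratios are compared with the one at \<open>m * k\<close>.\<close>

lemma funpow_ratio_diff:
  assumes f: "circle_lift f" and pos: "m > 0" "k > 0"
  shows "\<bar>(f ^^ m) 0 / real m - (f ^^ k) 0 / real k\<bar> \<le> 1 / real m + 1 / real k"
proof -
  have *: "\<bar>(f ^^ (m * k)) 0 / real (m * k) - (f ^^ k) 0 / real k\<bar> \<le> 1 / real k"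
    if "m > 0" "k > 0" for m k
  proof -
    have "(f ^^ (m * k)) 0 / real (m * k) - (f ^^ k) 0 / real k
        = ((f ^^ (m * k)) 0 - real m * (f ^^ k) 0) / real (m * k)"
      using that by (simp add: field_simps)
    also have "\<bar>\<dots>\<bar> \<le> real m / real (m * k)"
      unfolding abs_divide using circle_lift_funpow_mult_bound[OF f, of m k]
      by (simp add: divide_right_mono del: of_nat_mult)
    finally show ?thesis
      using that by simp
  qed
  show ?thesis
    using *[OF pos] *[OF pos(2,1)] by (simp add: mult.commute)
qed

lemma translation_number_LIMSEQ:
  assumes f: "circle_lift f"
  shows "(\<lambda>m. (f ^^ m) 0 / real m) \<longlonglongrightarrow> translation_number f"
proof -
  have "Cauchy (\<lambda>m. (f ^^ m) 0 / real m)"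
  proof (rule metric_CauchyI)
    fix e :: real assume e: "e > 0"
    then obtain M :: nat where M: "2 / e < real M"
      using reals_Archimedean2 by blast
    have M0: "M > 0"
      using M e by (cases M) (auto simp: divide_less_0_iff)
    have inv: "1 / real m < e / 2" if "m \<ge> M" for m
    proof -
      have "2 / e < real m"
        using M that by linarith
      then show ?thesis
        using e M0 that by (simp add: field_simps)
    qed
    have "dist ((f ^^ m) 0 / real m) ((f ^^ k) 0 / real k) < e" if "m \<ge> M" "k \<ge> M" for m k
      using funpow_ratio_diff[OF f, of m k] inv[OF that(1)] inv[OF that(2)] that M0
      by (simp add: dist_real_def)
    then show "\<exists>M. \<forall>m\<ge>M. \<forall>k\<ge>M. dist ((f ^^ m) 0 / real m) ((f ^^ k) 0 / real k) < e"
      by blast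
  qed
  then show ?thesis
    unfolding translation_number_def using Cauchy_convergent convergent_LIMSEQ_iff by blast
qed

lemma translation_number_funpow:
  assumes f: "circle_lift f"
  shows "translation_number (f ^^ k) = real k * translation_number f"
proof (cases "k = 0")
  case True
  have "(id :: real \<Rightarrow> real) ^^ m = id" for m
    by (induction m) auto
  with True show ?thesis
    by (simp add: translation_number_def)
next
  case False
  then have "filterlim (\<lambda>m. k * m) sequentially sequentially"
    by (intro filterlim_subseq) (auto simp: strict_mono_def)
  from filterlim_compose[OF translation_number_LIMSEQ[OF f] this]
  have "(\<lambda>m. real k * ((f ^^ (k * m)) 0 / real (k * m))) \<longlonglongrightarrow> real k * translation_number f"
    by (intro tendsto_mult_left)
  moreover have "real k * ((f ^^ (k * m)) 0 / real (k * m)) = ((f ^^ k) ^^ m) 0 / real m" for m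
    using False by (simp add: funpow_mult)
  ultimately have "(\<lambda>m. ((f ^^ k) ^^ m) 0 / real m) \<longlonglongrightarrow> real k * translation_number f"
    by simp
  then show ?thesis
    by (rule LIMSEQ_unique[OF translation_number_LIMSEQ[OF circle_lift_funpow[OF f]]])
qed

lemma translation_number_bound:
  assumes f: "circle_lift f"
  shows "\<bar>translation_number f - f 0\<bar> \<le> 1"
proof -
  have "(\<lambda>m. \<bar>(f ^^ m) 0 / real m - f 0\<bar>) \<longlonglongrightarrow> \<bar>translation_number f - f 0\<bar>"
    by (intro tendsto_intros translation_number_LIMSEQ f)
  moreover have "\<forall>\<^sub>F m in sequentially. \<bar>(f ^^ m) 0 / real m - f 0\<bar> \<le> 1"
    using eventually_gt_at_top[of 0]
  proof eventually_elim
    case (elim m)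
    have "\<bar>(f ^^ m) 0 - real m * f 0\<bar> / real m \<le> 1"
      using circle_lift_funpow_mult_bound[OF f, of m 1] elim by simp
    moreover have "(f ^^ m) 0 / real m - f 0 = ((f ^^ m) 0 - real m * f 0) / real m"
      using elim by (simp add: field_simps)
    ultimately show ?case
      by simp
  qed
  ultimately show ?thesis
    by (rule tendsto_upperbound) simp
qed

lemma translation_number_quasi:
  assumes f: "circle_lift f" and g: "circle_lift g"
  shows "\<bar>translation_number (g \<circ> f) - translation_number f - translation_number g\<bar> \<le> 4"
  using translation_number_bound[OF f] translation_number_bound[OF g]
    translation_number_bound[OF circle_lift_comp[OF f g]] circle_lift_add_bound[OF g, of "f 0"]
  by simp

text \<open>If the sum \<open>d\<close> of the two translation numbers were nonzero, then \<open>m d\<close> would be unbounded in \<open>m\<close>,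
  while it is the defect of the pair of \<open>m\<close>-th powers, whose composition is the identity.\<close>

lemma translation_number_inverse:
  assumes f: "circle_lift f" and g: "circle_lift g" and gf: "g \<circ> f = id"
  shows "translation_number g = - translation_number f"
proof (rule ccontr)
  define d where "d = translation_number f + translation_number g"
  assume "translation_number g \<noteq> - translation_number f"
  then have "\<bar>d\<bar> > 0"
    by (simp add: d_def)
  then obtain m :: nat where m: "4 < real m * \<bar>d\<bar>"
    using reals_Archimedean3[of "\<bar>d\<bar>"] by blast
  have "(g ^^ m) ((f ^^ m) x) = x" for x
  proof (induction m arbitrary: x)
    case (Suc m)
    have "(g ^^ Suc m) ((f ^^ Suc m) x) = (g ^^ m) ((g \<circ> f) ((f ^^ m) x))"
      by (simp add: funpow_swap1)
    then show ?case
      using Suc gf by simp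
  qed simp
  then have "g ^^ m \<circ> f ^^ m = f ^^ 0"
    by auto
  then have "translation_number (g ^^ m \<circ> f ^^ m) = 0"
    using translation_number_funpow[OF f, of 0] by simp
  then have "\<bar>real m * d\<bar> \<le> 4"
    using translation_number_quasi[OF circle_lift_funpow[OF f] circle_lift_funpow[OF g], of m m]
    by (simp add: translation_number_funpow f g d_def algebra_simps)
  then show False
    using m by (simp add: abs_mult)
qed

section \<open>Products that vanish in the abelianization\<close>

text \<open>Modulo the commutator subgroup of \<open>L\<close> the element \<open>h\<close> equals its conjugate \<open>k\<close>, so the displayed
  product becomes trivial in the abelianization of \<open>L\<close>. Concretely \<open>h k = h\<^sup>2 c\<close> for a
  commutator \<open>c\<close>, and normality allows all the factors \<open>c\<close> to be collected on the right.\<close>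

lemma (in group) conjugate_product_power_in_derived:
  assumes L: "subgroup L G" and h: "h \<in> L" and g: "g \<in> L"
  defines "k \<equiv> inv g \<otimes> h \<otimes> g"
  shows "inv (h [^] (2 * m)) \<otimes> (h \<otimes> k) [^] (m::nat) \<in> derived G L"
proof -
  interpret L: subgroup L G by fact
  interpret LL: group "G\<lparr>carrier := L\<rparr>"
    using L subgroup_imp_group by blast
  define D where "D = derived G L"
  have "D \<lhd> G\<lparr>carrier := L\<rparr>"
    unfolding D_def by (rule derived_subgroup_is_normal[OF L])
  then have conj: "inv x \<otimes> d \<otimes> x \<in> D" if "x \<in> L" "d \<in> D" for x d
    using normal.inv_op_closed1[of D "G\<lparr>carrier := L\<rparr>" x d] that m_inv_consistent[OF L] by simp
  have D: "subgroup D G"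
    unfolding D_def using derived_is_subgroup L.subset by blast
  have DG: "d \<in> carrier G" if "d \<in> D" for d
    using subgroup.mem_carrier[OF D] that .
  have hG [simp]: "h \<in> carrier G" "g \<in> carrier G"
    using h g by auto
  define c where "c = inv h \<otimes> k"
  have "c = inv h \<otimes> inv g \<otimes> inv (inv h) \<otimes> inv (inv g)"
    by (simp add: c_def k_def m_assoc)
  moreover have "inv h \<in> L" "inv g \<in> L"
    using h g by auto
  ultimately have "c \<in> derived_set G L"
    by blast
  then have cD: "c \<in> D"
    unfolding D_def derived_def by (rule generate.incl)
  \<comment> \<open>The product \<open>h k\<close> is a square times a commutator: \<open>k = h c\<close>.\<close>
  define a where "a = h [^] (2::nat)"
  have aG: "a \<in> carrier G" and aL: "a \<in> L"
    using h by (auto simp: a_def numeral_2_eq_2)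
  have cG: "c \<in> carrier G"
    using cD DG by blast
  have kG: "k \<in> carrier G"
    by (simp add: k_def)
  have hk: "h \<otimes> k = a \<otimes> c"
  proof -
    have "a = h \<otimes> h"
      by (simp add: a_def numeral_2_eq_2)
    moreover have "h \<otimes> c = k"
      by (simp add: c_def m_assoc[symmetric] kG)
    ultimately show ?thesis
      by (simp add: m_assoc cG)
  qed
  have "\<exists>d\<in>D. (a \<otimes> c) [^] m = a [^] m \<otimes> d"
  proof (induction m)
    case 0
    then show ?case
      using subgroup.one_closed[OF D] by (auto intro!: bexI[of _ \<one>])
  next
    case (Suc m)
    then obtain d where d: "d \<in> D" "(a \<otimes> c) [^] m = a [^] m \<otimes> d"
      by blast
    have dG: "d \<in> carrier G"
      using DG d(1) by blast
    have "d \<otimes> a = a \<otimes> (inv a \<otimes> d \<otimes> a)"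
      using aG dG by (simp add: m_assoc[symmetric])
    moreover have "(a \<otimes> c) [^] Suc m = a [^] m \<otimes> (d \<otimes> a) \<otimes> c"
      using aG cG dG by (simp add: d(2) m_assoc)
    ultimately have "(a \<otimes> c) [^] Suc m = a [^] m \<otimes> (a \<otimes> (inv a \<otimes> d \<otimes> a)) \<otimes> c"
      by simp
    also have "\<dots> = a [^] Suc m \<otimes> (inv a \<otimes> d \<otimes> a \<otimes> c)"
      using aG cG dG by (simp only: nat_pow_Suc m_assoc m_closed inv_closed nat_pow_closed)
    finally show ?case
      using subgroup.m_closed[OF D conj[OF aL d(1)] cD] by blast
  qed
  then obtain d where d: "d \<in> D" "(a \<otimes> c) [^] m = a [^] m \<otimes> d"
    by blast
  have "h [^] (2 * m) = a [^] m"
    by (simp add: a_def nat_pow_pow)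
  then have "inv (h [^] (2 * m)) \<otimes> (h \<otimes> k) [^] m = d"
    using d aG DG[OF d(1)] by (simp add: hk m_assoc[symmetric])
  then show ?thesis
    using d(1) by (simp add: D_def)
qed

section \<open>The ring of fractions with bounded denominators\<close>

lemma Z_inv_of_int: "of_int a \<in> Z_inv m"
  unfolding Z_inv_def by (auto intro!: exI[of _ a] exI[of _ "0::nat"])

lemma Z_inv_uminus: "x \<in> Z_inv m \<Longrightarrow> - x \<in> Z_inv m"
  unfolding Z_inv_def by (auto, metis minus_divide_left of_int_minus)

lemma Z_inv_mult: "x \<in> Z_inv m \<Longrightarrow> y \<in> Z_inv m \<Longrightarrow> x * y \<in> Z_inv m"
proof -
  assume "x \<in> Z_inv m" "y \<in> Z_inv m"
  then obtain a k b l where "x = of_int a / real m ^ k" "y = of_int b / real m ^ l"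
    by (auto simp: Z_inv_def)
  then have "x * y = of_int (a * b) / real m ^ (k + l)"
    by (simp add: power_add)
  then show ?thesis
    unfolding Z_inv_def by blast
qed

lemma Z_inv_add:
  assumes "m > 0" "x \<in> Z_inv m" "y \<in> Z_inv m"
  shows "x + y \<in> Z_inv m"
proof -
  obtain a k b l where xy: "x = of_int a / real m ^ k" "y = of_int b / real m ^ l"
    using assms by (auto simp: Z_inv_def)
  have "x + y = of_int (a * int m ^ l + b * int m ^ k) / real m ^ (k + l)"
    unfolding xy using assms(1) by (simp add: power_add field_simps)
  then show ?thesis
    unfolding Z_inv_def by blast
qed

lemma Z_inv_diff: "m > 0 \<Longrightarrow> x \<in> Z_inv m \<Longrightarrow> y \<in> Z_inv m \<Longrightarrow> x - y \<in> Z_inv m"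
  using Z_inv_add[of m x "- y"] Z_inv_uminus[of y m] by simp

lemma Z_inv_inverse_factor:
  assumes "a * b > 0"
  shows "1 / real a \<in> Z_inv (a * b)" "1 / real b \<in> Z_inv (a * b)"
proof -
  have "1 / real a = of_int (int b) / real (a * b) ^ 1" "1 / real b = of_int (int a) / real (a * b) ^ 1"
    using assms by auto
  then show "1 / real a \<in> Z_inv (a * b)" "1 / real b \<in> Z_inv (a * b)"
    unfolding Z_inv_def by blast+
qed

lemma Z_inv_power: "x \<in> Z_inv m \<Longrightarrow> x ^ k \<in> Z_inv m"
  using Z_inv_of_int[of 1 m] by (induction k) (auto intro: Z_inv_mult)

lemma Z_inv_powi:
  assumes "real a \<in> Z_inv m" "1 / real a \<in> Z_inv m"
  shows "real a powi i \<in> Z_inv m"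
  using Z_inv_power[OF assms(1)] Z_inv_power[OF assms(2)]
  by (simp add: power_int_def divide_inverse)

text \<open>The derivatives allowed in \<open>Gamma n\<close>. The numbers \<open>n\<close> and \<open>n + 1\<close> are coprime and greater
  than \<open>1\<close> for \<open>n \<ge> 2\<close>, so that the exponents are then determined by the value.\<close>

definition slope :: "nat \<Rightarrow> int \<Rightarrow> int \<Rightarrow> real" where
  "slope n i j = real n powi i * real (n + 1) powi j"

lemma slope_pos: "n > 0 \<Longrightarrow> slope n i j > 0"
  by (simp add: slope_def)

lemma slope_add: "n > 0 \<Longrightarrow> slope n i j * slope n i' j' = slope n (i + i') (j + j')"
  by (simp add: slope_def power_int_add)

lemma slope_zero [simp]: "slope n 0 0 = 1"
  by (simp add: slope_def)

lemma slope_uminus: "n > 0 \<Longrightarrow> slope n (- i) (- j) = 1 / slope n i j"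
  by (simp add: slope_def power_int_minus field_simps)

lemma slope_Z_inv:
  assumes "n > 0"
  shows "slope n i j \<in> Z_inv (n * (n + 1))"
proof -
  have *: "real a powi i \<in> Z_inv (n * (n + 1))" if "a \<in> {n, n + 1}" for a i
    using that Z_inv_inverse_factor[of n "n + 1"] assms Z_inv_of_int[of "int a" "n * (n + 1)"]
    by (intro Z_inv_powi) auto
  show ?thesis
    unfolding slope_def using *[of n i] *[of "n + 1" j] by (intro Z_inv_mult) simp_all
qed

text \<open>The slopes are units of the ring \<open>\<int>[1/(n(n+1))]\<close>, so an affine map with such a slope that is based
  at points of the ring can be inverted over the ring.\<close>

lemma affine_Z_inv_iff:
  assumes n: "n > 0" and "p \<in> Z_inv (n * (n + 1))" "a \<in> Z_inv (n * (n + 1))"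
  shows "a + slope n i j * (x - p) \<in> Z_inv (n * (n + 1)) \<longleftrightarrow> x \<in> Z_inv (n * (n + 1))"
proof -
  define y where "y = a + slope n i j * (x - p)"
  have "x = p + slope n (- i) (- j) * (y - a)"
    using slope_pos[OF n, of i j] by (simp add: slope_uminus[OF n] y_def)
  then show ?thesis
    using assms slope_Z_inv[OF n] unfolding y_def
    by (metis Z_inv_add Z_inv_diff Z_inv_mult add_pos_pos mult_pos_pos zero_less_one)
qed

section \<open>Increasing bijections of the line\<close>

abbreviation inverse_map :: "(real \<Rightarrow> real) \<Rightarrow> real \<Rightarrow> real" where
  "inverse_map f \<equiv> inv_into UNIV f"

lemma strict_mono_surj_homeomorphism:
  fixes f :: "real \<Rightarrow> real"
  assumes "strict_mono f" "surj f"
  shows "homeomorphism UNIV UNIV f (inverse_map f)" "strict_mono (inverse_map f)" "surj (inverse_map f)"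
proof -
  have inj: "inj f"
    using assms(1) by (rule strict_mono_imp_inj_on)
  have fi: "f (inverse_map f y) = y" "inverse_map f (f x) = x" for x y
    using assms(2) inj by (simp_all add: surj_f_inv_f)
  show inc: "strict_mono (inverse_map f)"
    by (rule strict_monoI) (metis assms(1) fi(1) strict_mono_less)
  show sur: "surj (inverse_map f)"
    by (metis fi(2) surjI)
  have cont: "continuous_on UNIV g" if "strict_mono g" "surj g" for g :: "real \<Rightarrow> real"
    using that by (intro continuous_onI_mono) (auto simp: strict_mono_less_eq)
  show "homeomorphism UNIV UNIV f (inverse_map f)"
    using assms(2) sur fi cont[OF assms] cont[OF inc sur] by (simp add: homeomorphism_def)
qed

lemma strict_mono_surj_filterlim:
  fixes f :: "real \<Rightarrow> real"
  assumes "strict_mono f" "surj f"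
  shows "filterlim f (at_right (f x)) (at_right x)" "filterlim f (at_left (f x)) (at_left x)"
    "filterlim f (at (f x)) (at x)"
proof -
  have "isCont f x"
    using strict_mono_surj_homeomorphism(1)[OF assms] continuous_on_eq_continuous_at
    by (auto simp: homeomorphism_def)
  then have tendsto: "(f \<longlongrightarrow> f x) (at x within S)" for S
    using isCont_def tendsto_within_subset by blast
  have "\<forall>\<^sub>F y in at_right x. f y \<in> {f x<..} \<and> f y \<noteq> f x"
    "\<forall>\<^sub>F y in at_left x. f y \<in> {..<f x} \<and> f y \<noteq> f x"
    "\<forall>\<^sub>F y in at x. f y \<in> UNIV \<and> f y \<noteq> f x"
    using assms(1) by (auto simp: eventually_at_filter strict_mono_less strict_mono_eq)
  then show "filterlim f (at_right (f x)) (at_right x)" "filterlim f (at_left (f x)) (at_left x)"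
    "filterlim f (at (f x)) (at x)"
    using tendsto by (auto simp: filterlim_at)
qed

section \<open>A group of maps described by their germs\<close>

text \<open>The map is affine near \<open>x\<close> along the filter \<open>F\<close>, and the exponents of its slope are tied to the
  change of the rounding function \<open>r\<close> under \<open>f\<close>. With \<open>r\<close> the floor function this is the condition on
  \<open>Gamma n\<close> at points where neither \<open>x\<close> nor \<open>f x\<close> is an integer, since \<open>\<lfloor>f x\<rfloor> - \<lfloor>x\<rfloor>\<close> is then the
  signed number of integers between \<open>x\<close> and \<open>f x\<close>. Writing it as a difference makes it an additive
  cocycle, which is what composition and inversion need.\<close>

definition affine_germ ::
    "nat \<Rightarrow> (real \<Rightarrow> int) \<Rightarrow> (real \<Rightarrow> real filter) \<Rightarrow> (real \<Rightarrow> real) \<Rightarrow> real \<Rightarrow> bool" where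
  "affine_germ n r F f x \<longleftrightarrow>
     (\<exists>i j. i - j = r (f x) - r x \<and> (\<forall>\<^sub>F y in F x. f y = f x + slope n i j * (y - x)))"

lemma affine_germ_id: "affine_germ n r F id x"
  unfolding affine_germ_def by (intro exI[of _ 0]) simp

lemma affine_germ_comp:
  assumes n: "n > 0" and f: "affine_germ n r F f x" and g: "affine_germ n r F g (f x)"
    and lim: "filterlim f (F (f x)) (F x)"
  shows "affine_germ n r F (g \<circ> f) x"
proof -
  obtain i j where ij: "i - j = r (f x) - r x" "\<forall>\<^sub>F y in F x. f y = f x + slope n i j * (y - x)"
    using f unfolding affine_germ_def by blast
  obtain k l where kl: "k - l = r (g (f x)) - r (f x)"
      "\<forall>\<^sub>F y in F (f x). g y = g (f x) + slope n k l * (y - f x)"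
    using g unfolding affine_germ_def by blast
  have "\<forall>\<^sub>F y in F x. g (f y) = g (f x) + slope n k l * (f y - f x)"
    using eventually_compose_filterlim[OF kl(2) lim] .
  then have "\<forall>\<^sub>F y in F x. (g \<circ> f) y = (g \<circ> f) x + slope n (k + i) (l + j) * (y - x)"
    using ij(2) by eventually_elim (simp add: slope_add[OF n, symmetric])
  moreover have "(k + i) - (l + j) = r ((g \<circ> f) x) - r x"
    using ij(1) kl(1) by simp
  ultimately show ?thesis
    unfolding affine_germ_def by blast
qed

lemma affine_germ_inv:
  assumes n: "n > 0" and f: "affine_germ n r F f x" and bij: "bij f"
    and lim: "filterlim (inverse_map f) (F x) (F (f x))"
  shows "affine_germ n r F (inverse_map f) (f x)"
proof -
  have fi: "f (inverse_map f y) = y" "inverse_map f (f x) = x" for x y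
    using bij by (simp_all add: bij_is_inj bij_is_surj surj_f_inv_f)
  obtain i j where ij: "i - j = r (f x) - r x" "\<forall>\<^sub>F y in F x. f y = f x + slope n i j * (y - x)"
    using f unfolding affine_germ_def by blast
  have "\<forall>\<^sub>F y in F (f x). f (inverse_map f y) = f x + slope n i j * (inverse_map f y - x)"
    using eventually_compose_filterlim[OF ij(2) lim] .
  then have "\<forall>\<^sub>F y in F (f x). inverse_map f y = inverse_map f (f x) + slope n (- i) (- j) * (y - f x)"
  proof eventually_elim
    case (elim y)
    then show ?case
      using slope_pos[OF n, of i j] by (simp add: fi slope_uminus[OF n] field_simps)
  qed
  moreover have "(- i) - (- j) = r (inverse_map f (f x)) - r (f x)"
    using ij(1) by (simp add: fi)
  ultimately show ?thesis
    unfolding affine_germ_def by blast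
qed

text \<open>Every point, integer or not, carries a right and a left germ. Just to the right of \<open>x\<close> the integer
  parts are governed by the floor of \<open>x\<close>, just to the left of \<open>x\<close> by its ceiling, which is why the
  one-sided germs use different rounding functions.\<close>

definition germ_group :: "nat \<Rightarrow> (real \<Rightarrow> real) set" where
  "germ_group n = {f. strict_mono f \<and> surj f \<and> (\<forall>t. f (t + 1) = f t + 1) \<and>
     (\<forall>x. f x \<in> Z_inv (n * (n + 1)) \<longleftrightarrow> x \<in> Z_inv (n * (n + 1))) \<and>
     (\<forall>x. affine_germ n floor at_right f x \<and> affine_germ n ceiling at_left f x \<and>
        (x \<notin> Z_inv (n * (n + 1)) \<longrightarrow> affine_germ n floor at f x))}"

lemma germ_group_comp:
  assumes n: "n > 0" and f: "f \<in> germ_group n" and g: "g \<in> germ_group n"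
  shows "g \<circ> f \<in> germ_group n"
proof -
  have sm: "strict_mono f" "surj f"
    using f by (auto simp: germ_group_def)
  note lim = strict_mono_surj_filterlim[OF sm]
  have germs: "affine_germ n floor at_right (g \<circ> f) x" "affine_germ n ceiling at_left (g \<circ> f) x"
    "x \<notin> Z_inv (n * (n + 1)) \<Longrightarrow> affine_germ n floor at (g \<circ> f) x" for x
    using f g unfolding germ_group_def by (auto intro!: affine_germ_comp[OF n] lim)
  have "strict_mono (g \<circ> f)"
    using f g by (auto simp: germ_group_def strict_mono_def)
  moreover have "surj (g \<circ> f)"
    using f g comp_surj unfolding germ_group_def by blast
  moreover have "(g \<circ> f) (t + 1) = (g \<circ> f) t + 1"
    "(g \<circ> f) t \<in> Z_inv (n * (n + 1)) \<longleftrightarrow> t \<in> Z_inv (n * (n + 1))" for t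
    using f g by (auto simp: germ_group_def)
  ultimately show ?thesis
    using germs unfolding germ_group_def by blast
qed

lemma germ_group_inv:
  assumes n: "n > 0" and f: "f \<in> germ_group n"
  shows "inverse_map f \<in> germ_group n"
proof -
  have sm: "strict_mono f" "surj f"
    using f by (auto simp: germ_group_def)
  have bij: "bij f"
    using sm by (auto simp: bij_def strict_mono_imp_inj_on)
  have fi: "f (inverse_map f y) = y" "inverse_map f (f x) = x" for x y
    using bij by (simp_all add: bij_is_inj bij_is_surj surj_f_inv_f)
  note inv = strict_mono_surj_homeomorphism(2,3)[OF sm]
  have lim: "filterlim (inverse_map f) (at_right x) (at_right (f x))"
    "filterlim (inverse_map f) (at_left x) (at_left (f x))"
    "filterlim (inverse_map f) (at x) (at (f x))" for x
    using strict_mono_surj_filterlim[OF inv, of "f x"] by (simp_all add: fi)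
  have germs: "affine_germ n floor at_right (inverse_map f) (f x) \<and> affine_germ n ceiling at_left (inverse_map f) (f x) \<and>
      (x \<notin> Z_inv (n * (n + 1)) \<longrightarrow> affine_germ n floor at (inverse_map f) (f x))" for x
    using f unfolding germ_group_def
    by (auto intro!: affine_germ_inv[OF n _ bij] lim)
  have "inverse_map f (t + 1) = inverse_map f t + 1" for t
  proof -
    have "f (inverse_map f t + 1) = t + 1"
      using f fi(1) by (simp add: germ_group_def)
    then show ?thesis
      by (metis fi(2))
  qed
  moreover have "inverse_map f x \<in> Z_inv (n * (n + 1)) \<longleftrightarrow> x \<in> Z_inv (n * (n + 1))" for x
    using f fi(1)[of x] unfolding germ_group_def by (metis (mono_tags, lifting) mem_Collect_eq)
  ultimately show ?thesis
    using inv germs[of "inverse_map f _"] unfolding germ_group_def by (simp add: fi)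
qed

lemma id_germ_group: "id \<in> germ_group n"
  unfolding germ_group_def by (auto simp: affine_germ_id strict_mono_def)

lemma germ_group_subgroup:
  assumes "n > 0"
  shows "subgroup (germ_group n) Homeo_plus"
proof -
  interpret group Homeo_plus by (rule group_Homeo_plus)
  have carrier: "f \<in> carrier Homeo_plus" if "f \<in> germ_group n" for f
    using that strict_mono_surj_homeomorphism(1)[of f] by (auto simp: germ_group_def Homeo_plus_def)
  have mult: "f \<otimes>\<^bsub>Homeo_plus\<^esub> g = g \<circ> f" for f g
    by (simp add: Homeo_plus_def)
  have "inv\<^bsub>Homeo_plus\<^esub> f \<in> germ_group n" if f: "f \<in> germ_group n" for f
  proof -
    have "f \<circ> inverse_map f = id"
      using f by (auto simp: germ_group_def fun_eq_iff surj_f_inv_f)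
    then have "inverse_map f \<otimes>\<^bsub>Homeo_plus\<^esub> f = \<one>\<^bsub>Homeo_plus\<^esub>"
      by (simp add: mult) (simp add: Homeo_plus_def)
    then have "inv\<^bsub>Homeo_plus\<^esub> f = inverse_map f"
      using inv_equality carrier f germ_group_inv[OF assms f] by blast
    then show ?thesis
      using germ_group_inv[OF assms f] by simp
  qed
  then show ?thesis
    using carrier id_germ_group[of n] germ_group_comp[OF assms]
    by (intro subgroupI) (auto simp: mult simp del: id_apply)
qed

lemma card_Ints_between:
  fixes x y :: real
  assumes "x \<notin> \<int>" "y \<notin> \<int>" "x \<le> y"
  shows "int (card (\<int> \<inter> {x<..<y})) = \<lfloor>y\<rfloor> - \<lfloor>x\<rfloor>"
proof -
  have ne: "of_int k \<noteq> x" "of_int k \<noteq> y" for k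
    using assms by auto
  have "\<int> \<inter> {x<..<y} = of_int ` {\<lfloor>x\<rfloor><..\<lfloor>y\<rfloor>}"
  proof (intro equalityI subsetI)
    fix z assume "z \<in> \<int> \<inter> {x<..<y}"
    then obtain k where k: "z = of_int k" "x < of_int k" "of_int k < y"
      by (auto elim: Ints_cases)
    then have "k \<in> {\<lfloor>x\<rfloor><..\<lfloor>y\<rfloor>}"
      by (simp add: floor_less_iff le_floor_iff)
    then show "z \<in> of_int ` {\<lfloor>x\<rfloor><..\<lfloor>y\<rfloor>}"
      using k by blast
  next
    fix z assume "z \<in> (of_int ` {\<lfloor>x\<rfloor><..\<lfloor>y\<rfloor>} :: real set)"
    then obtain k where k: "z = of_int k" "x < of_int k" "of_int k \<le> y"
      by (auto simp: floor_less_iff le_floor_iff)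
    then show "z \<in> \<int> \<inter> {x<..<y}"
      using ne(2)[of k] by auto
  qed
  moreover have "card (of_int ` {\<lfloor>x\<rfloor><..\<lfloor>y\<rfloor>} :: real set) = card {\<lfloor>x\<rfloor><..\<lfloor>y\<rfloor>}"
    by (intro card_image) (auto simp: inj_on_def)
  ultimately show ?thesis
    using floor_mono[OF assms(3)] by simp
qed

text \<open>The exceptional set consists of the points near which the map is not affine. One-sided germs make it
  closed and discrete, and on a connected piece of its complement the pair of slope and intercept is
  locally constant, hence constant.\<close>

lemma piecewise_linear_if_affine_germs:
  fixes f :: "real \<Rightarrow> real"
  assumes r: "\<And>x. \<exists>s. \<forall>\<^sub>F y in at_right x. f y = f x + s * (y - x)"
    and l: "\<And>x. \<exists>s. \<forall>\<^sub>F y in at_left x. f y = f x + s * (y - x)"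
  shows "piecewise_linear f"
proof -
  define A where "A = {x. \<exists>s c. \<forall>\<^sub>F y in nhds x. f y = s * y + c}"
  have nhds: "\<forall>\<^sub>F z in nhds x. \<forall>\<^sub>F y in nhds z. f y = s * y + c"
    if "\<forall>\<^sub>F y in nhds x. f y = s * y + c" for x s c
    using that by (simp add: eventually_eventually)
  have "open A"
    unfolding open_subopen[of A]
  proof
    fix x assume "x \<in> A"
    then obtain s c where "\<forall>\<^sub>F y in nhds x. f y = s * y + c"
      by (auto simp: A_def)
    from nhds[OF this] obtain U where "open U" "x \<in> U"
        "\<forall>z\<in>U. \<forall>\<^sub>F y in nhds z. f y = s * y + c"
      unfolding eventually_nhds[of _ x] by blast
    then show "\<exists>T. open T \<and> x \<in> T \<and> T \<subseteq> A"
      unfolding A_def by blast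
  qed
  have one_sided: "\<forall>\<^sub>F y in at x within H. y \<in> A"
    if s: "\<forall>\<^sub>F y in at x within H. f y = f x + s * (y - x)" and H: "open H" for x s H
  proof -
    obtain U where U: "open U" "x \<in> U" "\<And>y. y \<in> U \<Longrightarrow> y \<noteq> x \<Longrightarrow> y \<in> H \<Longrightarrow> f y = f x + s * (y - x)"
      using s unfolding eventually_at_topological by blast
    have "y \<in> A" if y: "y \<in> U" "y \<noteq> x" "y \<in> H" for y
    proof -
      have "open (U \<inter> H - {x})"
        using U H by auto
      then have "\<forall>\<^sub>F z in nhds y. z \<in> U \<inter> H - {x}"
        using y by (intro eventually_nhds_in_open) auto
      then have "\<forall>\<^sub>F z in nhds y. f z = s * z + (f x - s * x)"
        by eventually_elim (use U(3) in \<open>auto simp: algebra_simps\<close>)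
      then show ?thesis
        by (auto simp: A_def)
    qed
    then show ?thesis
      using U(1,2) unfolding eventually_at_topological by blast
  qed
  have "discrete (- A)"
    unfolding discrete_altdef
  proof
    fix x
    have "\<forall>\<^sub>F y in at_right x. y \<in> A"
      using r[of x] one_sided[where x = x and H = "{x<..}"] by auto
    moreover have "\<forall>\<^sub>F y in at_left x. y \<in> A"
      using l[of x] one_sided[where x = x and H = "{..<x}"] by auto
    ultimately show "\<forall>\<^sub>F y in at x. y \<notin> - A"
      by (simp add: eventually_at_split)
  qed
  moreover have "\<exists>a b. \<forall>x\<in>C. f x = a * x + b" if C: "C \<in> components A" for C
  proof -
    have CA: "C \<subseteq> A" and "connected C" "C \<noteq> {}"
      using C in_components_subset in_components_connected in_components_nonempty by blast+
    then obtain x0 where x0: "x0 \<in> C"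
      by blast
    \<comment> \<open>The pairs of slope and intercept that describe the map near \<open>x\<close>.\<close>
    define S where "S = (\<lambda>x. {(s, c). \<forall>\<^sub>F y in nhds x. f y = s * y + c})"
    have S_unique: "p = p'" if "p \<in> S x" "p' \<in> S x" for p p' x
    proof -
      obtain s c s' c' where p: "p = (s, c)" "p' = (s', c')"
        by (cases p, cases p')
      have "\<forall>\<^sub>F y in nhds x. (s - s') * y + (c - c') = 0"
        using that unfolding S_def p
        by (auto simp: algebra_simps elim: eventually_elim2)
      then obtain e where e: "e > 0" "\<And>y. dist y x < e \<Longrightarrow> (s - s') * y + (c - c') = 0"
        unfolding eventually_nhds_metric by blast
      have "(s - s') * x + (c - c') = 0" "(s - s') * (x + e / 2) + (c - c') = 0"
        using e by (auto simp: dist_real_def)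
      moreover have "(s - s') * (x + e / 2) = (s - s') * x + (s - s') * (e / 2)"
        by (rule distrib_left)
      ultimately have "(s - s') * (e / 2) = 0" "(s - s') * x + (c - c') = 0"
        by linarith+
      then show ?thesis
        using e(1) p by auto
    qed
    have "S x = S x0" if "x \<in> C" for x
    proof (rule connected_local_const[OF \<open>connected C\<close> that x0], rule ballI)
      fix a assume "a \<in> C"
      then obtain s c where "\<forall>\<^sub>F y in nhds a. f y = s * y + c"
        using CA by (auto simp: A_def)
      then have sc: "(s, c) \<in> S a" and near: "\<forall>\<^sub>F z in nhds a. (s, c) \<in> S z"
        using nhds by (auto simp: S_def)
      from near have "\<forall>\<^sub>F z in nhds a. S a = S z"
        by eventually_elim (use S_unique sc in blast)
      then show "\<forall>\<^sub>F z in at a within C. S a = S z"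
        unfolding eventually_at_filter by (rule eventually_mono) simp
    qed
    moreover obtain s c where "(s, c) \<in> S x0"
      using CA x0 by (auto simp: A_def S_def)
    ultimately have "(s, c) \<in> S x" if "x \<in> C" for x
      using that by blast
    then have "f x = s * x + c" if "x \<in> C" for x
      using that by (auto simp: S_def dest: eventually_nhds_x_imp_x)
    then show ?thesis
      by blast
  qed
  ultimately show ?thesis
    unfolding piecewise_linear_def using \<open>open A\<close>
    by (intro exI[of _ "- A"]) (auto simp: closed_def)
qed

lemma affine_imp_derivative:
  assumes "\<forall>\<^sub>F y in at x. f y = f x + s * (y - (x::real))"
  shows "(f has_real_derivative s) (at x)"
proof -
  have "((\<lambda>y. f x + s * (y - x)) has_real_derivative s) (at x)"
    by (auto intro!: derivative_eq_intros)
  moreover have "\<forall>\<^sub>F y in nhds x. f y = f x + s * (y - x)"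
    using assms unfolding eventually_at_filter by (rule eventually_mono) auto
  ultimately show ?thesis
    by (subst DERIV_cong_ev[OF refl _ refl])
qed

lemma breakpoint_not_differentiable:
  assumes "breakpoint f x" "(f has_real_derivative s) (at x)"
  shows False
proof -
  obtain l r where l: "(f has_real_derivative l) (at_left x)"
    and r: "(f has_real_derivative r) (at_right x)" and "l \<noteq> r"
    using assms(1) by (auto simp: breakpoint_def)
  have "((\<lambda>y. (f y - f x) / (y - x)) \<longlongrightarrow> s) (at_left x)"
    "((\<lambda>y. (f y - f x) / (y - x)) \<longlongrightarrow> s) (at_right x)"
    using assms(2) by (auto simp: has_field_derivative_iff intro: tendsto_within_subset)
  then have "l = s" "r = s"
    using l r by (auto simp: has_field_derivative_iff intro: tendsto_unique[rotated])
  then show False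
    using \<open>l \<noteq> r\<close> by simp
qed

lemma germ_group_subset_Gamma:
  assumes n: "n > 0"
  shows "germ_group n \<subseteq> Gamma n"
proof
  fix f assume f: "f \<in> germ_group n"
  define R where "R = Z_inv (n * (n + 1))"
  have R_iff: "f x \<in> R \<longleftrightarrow> x \<in> R" and surj: "surj f" and per: "f (t + 1) = f t + 1" for x t
    using f by (auto simp: germ_group_def R_def)
  have Ints: "x \<notin> \<int>" if "x \<notin> R" for x
    using that Z_inv_of_int by (auto simp: R_def elim!: Ints_cases)
  have deriv: "\<exists>i j. (f has_real_derivative slope n i j) (at x) \<and> i - j = \<lfloor>f x\<rfloor> - \<lfloor>x\<rfloor>"
    if "x \<notin> R" for x
    using f that affine_imp_derivative unfolding germ_group_def affine_germ_def R_def by blast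
  have "piecewise_linear f"
    using f unfolding germ_group_def affine_germ_def
    by (intro piecewise_linear_if_affine_germs) blast+
  moreover have "x \<in> R" if "breakpoint f x" for x
    using that deriv breakpoint_not_differentiable by blast
  moreover have "f ` R = R"
    using surj R_iff by (metis image_subset_iff set_eq_subset subsetI surjD rev_image_eqI)
  moreover have "\<exists>i j. (f has_real_derivative real n powi i * real (n + 1) powi j) (at x) \<and>
      (x \<le> f x \<longrightarrow> i - j = int (card (\<int> \<inter> {x<..<f x}))) \<and>
      (f x < x \<longrightarrow> i - j = - int (card (\<int> \<inter> {f x<..<x})))" if x: "x \<notin> R" for x
  proof -
    obtain i j where "(f has_real_derivative slope n i j) (at x)" "i - j = \<lfloor>f x\<rfloor> - \<lfloor>x\<rfloor>"
      using deriv[OF x] by blast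
    moreover have "x \<notin> \<int>" "f x \<notin> \<int>"
      using Ints x R_iff by blast+
    ultimately show ?thesis
      using card_Ints_between[of x "f x"] card_Ints_between[of "f x" x] unfolding slope_def
      by (intro exI[of _ i] exI[of _ j]) auto
  qed
  ultimately show "f \<in> Gamma n"
    using per subgroup.mem_carrier[OF germ_group_subgroup[OF n] f]
    unfolding Gamma_def R_def by blast
qed

section \<open>Maps with three affine pieces\<close>

text \<open>On a piece whose image lies between two consecutive integers the rounding functions are constant
  along domain and image, so a single relation \<open>i - j \<le> a\<close>, \<open>a + s (q - p) \<le> i - j + 1\<close> settles
  the exponent condition at all its points. The shift by \<open>k\<close> serves all the translates of the piece
  at once.\<close>

lemma affine_piece_germs:
  fixes k :: int and p q a s :: real
  defines "x0 \<equiv> of_int k + p" and "x1 \<equiv> of_int k + q"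
  assumes eq: "\<And>x. x0 \<le> x \<Longrightarrow> x \<le> x1 \<Longrightarrow> f x = of_int k + a + s * (x - x0)"
    and s_eq: "s = slope n i j" and n: "n > 0" and "0 \<le> p" "q \<le> 1"
    and "of_int (i - j) \<le> a" "a + s * (q - p) \<le> of_int (i - j) + 1"
  shows "x0 \<le> x \<Longrightarrow> x < x1 \<Longrightarrow> affine_germ n floor at_right f x"
    and "x0 < x \<Longrightarrow> x \<le> x1 \<Longrightarrow> affine_germ n ceiling at_left f x"
    and "x0 < x \<Longrightarrow> x < x1 \<Longrightarrow> affine_germ n floor at f x"
proof -
  have s: "s > 0"
    using slope_pos[OF n] s_eq by simp
  have diff: "f y = f x + s * (y - x)" if "x0 \<le> x" "x \<le> x1" "x0 \<le> y" "y \<le> x1" for x y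
    using eq[of x] eq[of y] that by (simp add: algebra_simps)
  have total: "s * (q - p) = s * (x1 - x0)"
    by (simp add: x0_def x1_def)
  have floor: "i - j = \<lfloor>f x\<rfloor> - \<lfloor>x\<rfloor>" if x: "x0 \<le> x" "x < x1" for x
  proof -
    have "s * (x - x0) \<ge> 0" "s * (x - x0) < s * (x1 - x0)"
      using s x by auto
    then have "of_int (k + (i - j)) \<le> f x" "f x < of_int (k + (i - j)) + 1"
      using eq[of x] assms(6-9) x total by auto
    moreover have "of_int k \<le> x" "x < of_int k + 1"
      using x assms(6,7) by (auto simp: x0_def x1_def)
    ultimately have "\<lfloor>f x\<rfloor> = k + (i - j)" "\<lfloor>x\<rfloor> = k"
      by (simp_all only: floor_eq_iff)
    then show ?thesis
      by simp
  qed
  have ceiling: "i - j = \<lceil>f x\<rceil> - \<lceil>x\<rceil>" if x: "x0 < x" "x \<le> x1" for x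
  proof -
    have "s * (x - x0) > 0" "s * (x - x0) \<le> s * (x1 - x0)"
      using s x by auto
    then have "of_int (k + (i - j) + 1) - 1 < f x" "f x \<le> of_int (k + (i - j) + 1)"
      using eq[of x] assms(6-9) x total by auto
    moreover have "of_int (k + 1) - 1 < x" "x \<le> of_int (k + 1)"
      using x assms(6,7) by (auto simp: x0_def x1_def)
    ultimately have "\<lceil>f x\<rceil> = k + (i - j) + 1" "\<lceil>x\<rceil> = k + 1"
      by (simp_all only: ceiling_eq_iff)
    then show ?thesis
      by simp
  qed
  show "affine_germ n floor at_right f x" if x: "x0 \<le> x" "x < x1"
  proof -
    have "\<forall>\<^sub>F y in at_right x. f y = f x + slope n i j * (y - x)"
    proof (rule eventually_mono[OF eventually_at_right_real[OF x(2)]])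
      fix y assume "y \<in> {x<..<x1}"
      then show "f y = f x + slope n i j * (y - x)"
        using x diff[of x y] s_eq by simp
    qed
    then show ?thesis
      unfolding affine_germ_def using floor[OF x] by blast
  qed
  show "affine_germ n ceiling at_left f x" if x: "x0 < x" "x \<le> x1"
  proof -
    have "\<forall>\<^sub>F y in at_left x. f y = f x + slope n i j * (y - x)"
    proof (rule eventually_mono[OF eventually_at_left_real[OF x(1)]])
      fix y assume "y \<in> {x0<..<x}"
      then show "f y = f x + slope n i j * (y - x)"
        using x diff[of x y] s_eq by simp
    qed
    then show ?thesis
      unfolding affine_germ_def using ceiling[OF x] by blast
  qed
  show "affine_germ n floor at f x" if x: "x0 < x" "x < x1"
  proof -
    have "\<forall>\<^sub>F y in at x. y \<in> {x0<..<x1}"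
      using x by (intro eventually_at_in_open') auto
    then have "\<forall>\<^sub>F y in at x. f y = f x + slope n i j * (y - x)"
    proof (rule eventually_mono)
      fix y assume "y \<in> {x0<..<x1}"
      then show "f y = f x + slope n i j * (y - x)"
        using x diff[of x y] s_eq by simp
    qed
    then show ?thesis
      unfolding affine_germ_def using floor[of x] x by auto
  qed
qed

text \<open>The slopes \<open>s1\<close>, \<open>s2\<close>, \<open>s3\<close> apply before \<open>p\<close>, between \<open>p\<close> and \<open>q\<close>, and after \<open>q\<close>. Clamping
  the argument instead of distinguishing cases makes continuity and monotonicity immediate.\<close>

definition profile :: "real \<Rightarrow> real \<Rightarrow> real \<Rightarrow> real \<Rightarrow> real \<Rightarrow> real \<Rightarrow> real" where
  "profile p q s1 s2 s3 t = s1 * min t p + s2 * (max p (min t q) - p) + s3 * (max t q - q)"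

definition three_piece :: "real \<Rightarrow> real \<Rightarrow> real \<Rightarrow> real \<Rightarrow> real \<Rightarrow> real \<Rightarrow> real \<Rightarrow> real" where
  "three_piece c p q s1 s2 s3 x = of_int \<lfloor>x\<rfloor> + c + profile p q s1 s2 s3 (frac x)"

lemma profile_strict_mono:
  assumes "p < q" "s1 > 0" "s2 > 0" "s3 > 0"
  shows "strict_mono (profile p q s1 s2 s3)"
proof (rule strict_monoI)
  fix x y :: real assume "x < y"
  have le: "min x p \<le> min y p" "max p (min x q) \<le> max p (min y q)" "max x q \<le> max y q"
    using \<open>x < y\<close> by auto
  have le': "s1 * min x p \<le> s1 * min y p"
    "s2 * (max p (min x q) - p) \<le> s2 * (max p (min y q) - p)"
    "s3 * (max x q - q) \<le> s3 * (max y q - q)"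
    using le assms by (auto intro!: mult_left_mono)
  consider "y \<le> p" | "x \<ge> q" | "x < q" "y > p"
    by linarith
  then consider "min x p < min y p" | "max p (min x q) < max p (min y q)" | "max x q < max y q"
    using \<open>x < y\<close> \<open>p < q\<close> by cases auto
  then have "s1 * min x p < s1 * min y p \<or>
    s2 * (max p (min x q) - p) < s2 * (max p (min y q) - p) \<or> s3 * (max x q - q) < s3 * (max y q - q)"
    using assms by cases auto
  then show "profile p q s1 s2 s3 x < profile p q s1 s2 s3 y"
    unfolding profile_def using le' by linarith
qed

lemma continuous_on_profile: "continuous_on A (profile p q s1 s2 s3)"
  unfolding profile_def by (intro continuous_intros)

text \<open>The formula stays valid at the right end of the cell because the slopes are balanced to make the profile gain
  exactly \<open>1\<close> over the unit interval.\<close>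

lemma three_piece_cell:
  assumes "0 < p" "p < q" "q < 1" "s1 * p + s2 * (q - p) + s3 * (1 - q) = 1"
    and "of_int k \<le> x" "x \<le> of_int k + 1"
  shows "three_piece c p q s1 s2 s3 x = of_int k + c + profile p q s1 s2 s3 (x - of_int k)"
proof (cases "x = of_int k + 1")
  case True
  then have "\<lfloor>x\<rfloor> = k + 1" "frac x = 0"
    by (auto simp: frac_def)
  then show ?thesis
    using assms True by (simp add: three_piece_def profile_def)
next
  case False
  then have "\<lfloor>x\<rfloor> = k"
    using assms by (auto simp: floor_eq_iff)
  then show ?thesis
    by (simp add: three_piece_def frac_def)
qed

lemma three_piece_bij:
  assumes pq: "0 < p" "p < q" "q < 1" and s: "s1 > 0" "s2 > 0" "s3 > 0"
    and total: "s1 * p + s2 * (q - p) + s3 * (1 - q) = 1"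
  shows "strict_mono (three_piece c p q s1 s2 s3)" "surj (three_piece c p q s1 s2 s3)"
proof -
  let ?u = "profile p q s1 s2 s3" and ?f = "three_piece c p q s1 s2 s3"
  note mono = profile_strict_mono[OF pq(2) s]
  have u01: "?u 0 = 0" "?u 1 = 1"
    using pq total by (auto simp: profile_def)
  show "strict_mono ?f"
  proof (rule strict_monoI)
    fix x y :: real assume "x < y"
    show "?f x < ?f y"
    proof (cases "\<lfloor>x\<rfloor> = \<lfloor>y\<rfloor>")
      case True
      then show ?thesis
        using \<open>x < y\<close> mono by (simp add: three_piece_def frac_def strict_mono_less)
    next
      case False
      then have "\<lfloor>x\<rfloor> + 1 \<le> \<lfloor>y\<rfloor>"
        using floor_mono[of x y] \<open>x < y\<close> by simp
      then have "real_of_int \<lfloor>x\<rfloor> + 1 \<le> of_int \<lfloor>y\<rfloor>"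
        by linarith
      moreover have "?u (frac x) < ?u 1" "?u 0 \<le> ?u (frac y)"
        using mono by (simp_all add: strict_mono_less strict_mono_less_eq frac_lt_1)
      ultimately show ?thesis
        by (simp add: three_piece_def u01)
    qed
  qed
  show "surj ?f"
  proof (rule surjI)
    fix y :: real
    let ?k = "\<lfloor>y - c\<rfloor>"
    have "?u 0 \<le> y - c - of_int ?k" "y - c - of_int ?k \<le> ?u 1"
      unfolding u01 by linarith+
    then have "\<exists>t\<ge>0. t \<le> 1 \<and> ?u t = y - c - of_int ?k"
      by (intro IVT' continuous_on_profile) simp_all
    then obtain t where t: "0 \<le> t" "t \<le> 1" "?u t = y - c - of_int ?k"
      by blast
    then have "?f (of_int ?k + t) = y"
      using three_piece_cell[OF pq total, of ?k "of_int ?k + t" c] by simp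
    then show "?f (SOME x. ?f x = y) = y"
      by (rule someI)
  qed
qed

lemma three_piece_in_germ_group:
  fixes n :: nat and i1 j1 i2 j2 i3 j3 :: int
  defines "s1 \<equiv> slope n i1 j1" and "s2 \<equiv> slope n i2 j2" and "s3 \<equiv> slope n i3 j3"
  assumes n: "n > 0" and pq: "0 < p" "p < q" "q < 1"
    and R: "p \<in> Z_inv (n * (n + 1))" "q \<in> Z_inv (n * (n + 1))" "c \<in> Z_inv (n * (n + 1))"
    and total: "s1 * p + s2 * (q - p) + s3 * (1 - q) = 1"
    and c1: "of_int (i1 - j1) \<le> c" "c + s1 * p \<le> of_int (i1 - j1) + 1"
    and c2: "of_int (i2 - j2) \<le> c + s1 * p" "c + s1 * p + s2 * (q - p) \<le> of_int (i2 - j2) + 1"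
    and c3: "of_int (i3 - j3) \<le> c + s1 * p + s2 * (q - p)" "c + 1 \<le> of_int (i3 - j3) + 1"
  shows "three_piece c p q s1 s2 s3 \<in> germ_group n"
proof -
  let ?f = "three_piece c p q s1 s2 s3"
  let ?R = "Z_inv (n * (n + 1))"
  have s_eq: "s1 = slope n i1 j1" "s2 = slope n i2 j2" "s3 = slope n i3 j3"
    by (simp_all add: s1_def s2_def s3_def)
  have s: "s1 > 0" "s2 > 0" "s3 > 0"
    using slope_pos[OF n] by (auto simp: s1_def s2_def s3_def)
  have sR: "s1 \<in> ?R" "s2 \<in> ?R" "s3 \<in> ?R"
    using slope_Z_inv[OF n] by (auto simp: s1_def s2_def s3_def)
  have N: "n * (n + 1) > 0"
    using n by simp
  note cell = three_piece_cell[OF pq total, of _ _ c]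
  have e1: "?f x = of_int k + c + s1 * (x - (of_int k + 0))"
    if "of_int k + 0 \<le> x" "x \<le> of_int k + p" for x k
    using cell[of k x] that pq by (simp add: profile_def)
  have e2: "?f x = of_int k + (c + s1 * p) + s2 * (x - (of_int k + p))"
    if "of_int k + p \<le> x" "x \<le> of_int k + q" for x k
    using cell[of k x] that pq by (simp add: profile_def algebra_simps)
  have e3: "?f x = of_int k + (c + s1 * p + s2 * (q - p)) + s3 * (x - (of_int k + q))"
    if "of_int k + q \<le> x" "x \<le> of_int k + 1" for x k
    using cell[of k x] that pq by (simp add: profile_def algebra_simps)
  have side: "0 \<le> p" "0 \<le> q" "p \<le> 1" "q \<le> 1" "(0::real) \<le> 0" "(1::real) \<le> 1"
    "c + s1 * (p - 0) \<le> of_int (i1 - j1) + 1"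
    "c + s1 * p + s2 * (q - p) + s3 * (1 - q) \<le> of_int (i3 - j3) + 1"
    using pq c1 c3 total by auto
  have r: "affine_germ n floor at_right ?f x" for x
  proof -
    define k where "k = \<lfloor>x\<rfloor>"
    have k: "of_int k \<le> x" "x < of_int k + 1"
      by (auto simp: k_def)
    note g1 = affine_piece_germs(1)[OF e1[where k = k] s_eq(1) n side(5) side(3) c1(1) side(7), of x]
    note g2 = affine_piece_germs(1)[OF e2[where k = k] s_eq(2) n side(1) side(4) c2, of x]
    note g3 = affine_piece_germs(1)[OF e3[where k = k] s_eq(3) n side(2) side(6) c3(1) side(8), of x]
    show ?thesis
      using g1 g2 g3 k by linarith
  qed
  have l: "affine_germ n ceiling at_left ?f x" for x
  proof -
    define k where "k = \<lceil>x\<rceil> - 1"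
    have k: "of_int k < x" "x \<le> of_int k + 1"
      unfolding k_def by linarith+
    note g1 = affine_piece_germs(2)[OF e1[where k = k] s_eq(1) n side(5) side(3) c1(1) side(7), of x]
    note g2 = affine_piece_germs(2)[OF e2[where k = k] s_eq(2) n side(1) side(4) c2, of x]
    note g3 = affine_piece_germs(2)[OF e3[where k = k] s_eq(3) n side(2) side(6) c3(1) side(8), of x]
    show ?thesis
      using g1 g2 g3 k by linarith
  qed
  have m: "affine_germ n floor at ?f x" if "x \<notin> ?R" for x
  proof -
    define k where "k = \<lfloor>x\<rfloor>"
    have "x \<noteq> of_int k" "x \<noteq> of_int k + p" "x \<noteq> of_int k + q"
      using that R Z_inv_of_int Z_inv_add[OF N] by auto
    moreover have "of_int k \<le> x" "x < of_int k + 1"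
      by (auto simp: k_def)
    moreover note affine_piece_germs(3)[OF e1[where k = k] s_eq(1) n side(5) side(3) c1(1) side(7), of x]
      affine_piece_germs(3)[OF e2[where k = k] s_eq(2) n side(1) side(4) c2, of x]
      affine_piece_germs(3)[OF e3[where k = k] s_eq(3) n side(2) side(6) c3(1) side(8), of x]
    ultimately show ?thesis
      by linarith
  qed
  have iff: "?f x \<in> ?R \<longleftrightarrow> x \<in> ?R" for x
  proof -
    define k where "k = \<lfloor>x\<rfloor>"
    have k: "of_int k \<le> x" "x < of_int k + 1"
      by (auto simp: k_def)
    have kR: "of_int k \<in> ?R"
      by (rule Z_inv_of_int)
    then have base0: "of_int k + 0 \<in> ?R"
      by simp
    have base: "of_int k + p \<in> ?R" "of_int k + q \<in> ?R" "of_int k + c \<in> ?R"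
      "of_int k + (c + s1 * p) \<in> ?R" "of_int k + (c + s1 * p + s2 * (q - p)) \<in> ?R"
      by (intro Z_inv_add[OF N] Z_inv_mult Z_inv_diff[OF N] kR R sR)+
    consider "x < of_int k + p" | "of_int k + p \<le> x" "x < of_int k + q" | "of_int k + q \<le> x"
      by linarith
    then show ?thesis
    proof cases
      case 1
      then have "?f x = of_int k + c + s1 * (x - (of_int k + 0))"
        using e1[of k x] k by simp
      then show ?thesis
        using affine_Z_inv_iff[OF n base0 base(3), of i1 j1 x] by (simp only: s_eq)
    next
      case 2
      then have "?f x = of_int k + (c + s1 * p) + s2 * (x - (of_int k + p))"
        using e2[of k x] by simp
      then show ?thesis
        using affine_Z_inv_iff[OF n base(1,4), of i2 j2 x] by (simp only: s_eq)
    next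
      case 3
      then have "?f x = of_int k + (c + s1 * p + s2 * (q - p)) + s3 * (x - (of_int k + q))"
        using e3[of k x] k by simp
      then show ?thesis
        using affine_Z_inv_iff[OF n base(2,5), of i3 j3 x] by (simp only: s_eq)
    qed
  qed
  have "?f (t + 1) = ?f t + 1" for t
    by (simp add: three_piece_def frac_1_eq)
  then show ?thesis
    using three_piece_bij[OF pq s total] iff r l m unfolding germ_group_def by blast
qed

text \<open>With \<open>N = n (n + 1)\<close> the map has slopes \<open>N\<close>, \<open>1\<close>, \<open>1/N\<close> on the unit interval, broken at
  \<open>1/N\<^sup>2\<close> and \<open>1 - 1/N\<close>. It preserves the unit interval, so equal exponents of \<open>n\<close> and \<open>n + 1\<close>
  are required, and the graph is concave with end points on the diagonal, hence above the diagonal.\<close>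

lemma pushing_element:
  assumes n: "n \<ge> 2"
  obtains h where "h \<in> germ_group n" "\<And>k::int. h (of_int k) = of_int k"
    "\<And>x. x \<notin> \<int> \<Longrightarrow> x < h x"
proof -
  define N where "N = real n * (real n + 1)"
  have "real n \<ge> 2"
    using n by simp
  then have "2 * 3 \<le> N"
    unfolding N_def by (intro mult_mono) auto
  then have N: "N > 2"
    by simp
  define e where "e = 1 / N"
  have e: "0 < e" "e < 1 / 2" "N * e = 1"
    using N by (auto simp: e_def field_simps)
  define p q where "p = e * e" and "q = 1 - e"
  have "e * e < e * 1" "0 < e * e"
    using e by (intro mult_strict_left_mono mult_pos_pos; simp)+
  then have pq: "0 < p" "p < q" "q < 1"
    unfolding p_def q_def using e(1,2) by linarith+
  have sl: "slope n 1 1 = N" "slope n (- 1) (- 1) = e"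
    using n by (auto simp: slope_def N_def e_def power_int_minus field_simps)
  have "e \<in> Z_inv (n * (n + 1))"
    using slope_Z_inv[of n "-1" "-1"] n sl by simp
  then have R: "p \<in> Z_inv (n * (n + 1))" "q \<in> Z_inv (n * (n + 1))"
    using Z_inv_mult[of e _ e] Z_inv_diff[of "n * (n + 1)" 1 e] n Z_inv_of_int[of 1]
    by (auto simp: p_def q_def)
  have Np: "N * p = e"
    using e by (simp add: p_def mult.assoc[symmetric])
  have total: "N * p + 1 * (q - p) + e * (1 - q) = 1"
    unfolding Np by (simp add: p_def q_def)
  define h where "h = three_piece 0 p q N 1 e"
  have "h \<in> germ_group n"
    using three_piece_in_germ_group[of n p q 0 1 1 0 0 "-1" "-1", unfolded sl slope_zero] n pq R total
      Z_inv_of_int[of 0] N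
    by (simp add: h_def Np q_def)
  moreover have "h (of_int k) = of_int k" for k
    using pq by (simp add: h_def three_piece_def profile_def)
  moreover have "x < h x" if "x \<notin> \<int>" for x
  proof -
    define t where "t = frac x"
    have t: "0 < t" "t < 1"
      using that frac_gt_0_iff by (auto simp: t_def frac_lt_1)
    consider "t \<le> p" | "p < t" "t \<le> q" | "q < t"
      by linarith
    then have "t < profile p q N 1 e t"
    proof cases
      case 1
      then show ?thesis
        using pq N t by (simp add: profile_def)
    next
      case 2
      have "p < N * p"
        using pq N by simp
      then show ?thesis
        using 2 pq by (simp add: profile_def)
    next
      case 3
      have "profile p q N 1 e t = 1 - (1 - t) * e"
        using 3 pq Np by (simp add: profile_def) (simp add: p_def q_def algebra_simps)
      moreover have "(1 - t) * e < 1 - t"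
        using e t mult_strict_left_mono[of e 1 "1 - t"] by simp
      ultimately show ?thesis
        by linarith
    qed
    then show ?thesis
      unfolding h_def three_piece_def t_def by (simp add: frac_def)
  qed
  ultimately show ?thesis
    using that by blast
qed

text \<open>With \<open>N = n (n + 1)\<close> the map sends \<open>0\<close> to \<open>1 - 1/N\<close>. It translates \<open>[0, 1/N]\<close> onto
  \<open>[1 - 1/N, 1]\<close> without crossing an integer, and sends \<open>[1/N, 1]\<close> onto an interval of the same
  length beginning at \<open>1\<close>. Points of the latter cross one integer, so their slopes must satisfy
  \<open>i - j = 1\<close> and the translation is forbidden. Instead the interval is cut at \<open>1/n\<close> and given the
  slopes \<open>n\<close> and \<open>1/(n + 1)\<close>, and the identity
  \<open>n (1/n - 1/N) + (1 - 1/n) / (n + 1) = 1 - 1/N\<close> restores the total length.\<close>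

lemma element_moving_integers_off_integers:
  assumes n: "n \<ge> 2"
  obtains g where "g \<in> germ_group n" "\<And>k::int. g (of_int k) \<notin> \<int>"
proof -
  define N where "N = real n * (real n + 1)"
  have n2: "real n \<ge> 2"
    using n by simp
  then have "2 * 3 \<le> N"
    unfolding N_def by (intro mult_mono) auto
  then have N: "N > 2"
    by simp
  define c p q where "c = 1 - 1 / N" and "p = 1 / N" and "q = 1 / real n"
  have pq: "0 < p" "p < q" "q < 1"
  proof -
    have "real n < N"
      using n2 by (simp add: N_def algebra_simps)
    then show "0 < p" "p < q" "q < 1"
      using n2 N by (simp_all add: p_def q_def divide_strict_left_mono)
  qed
  have sl: "slope n 1 0 = real n" "slope n 0 (- 1) = 1 / (real n + 1)"
    using n by (auto simp: slope_def power_int_minus field_simps)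
  have sl': "slope n (- 1) (- 1) = 1 / N" "slope n (- 1) 0 = 1 / real n"
    using n by (auto simp: slope_def N_def power_int_minus field_simps)
  have "1 / N \<in> Z_inv (n * (n + 1))" "1 / real n \<in> Z_inv (n * (n + 1))"
    using slope_Z_inv[of n "-1" "-1"] slope_Z_inv[of n "-1" "0"] n sl' by simp_all
  then have R: "p \<in> Z_inv (n * (n + 1))" "q \<in> Z_inv (n * (n + 1))" "c \<in> Z_inv (n * (n + 1))"
    using Z_inv_diff[of "n * (n + 1)" 1 "1 / N"] n Z_inv_of_int[of 1]
    by (auto simp: p_def q_def c_def)
  \<comment> \<open>The slope of the third piece; \<open>1/N = (1/n) a\<close> and \<open>1 - a = n/(n+1)\<close> is the length of the
    image of the second piece.\<close>
  define a where "a = 1 / (real n + 1)"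
  have "p = q * a" and "real n * q = 1"
    using n2 by (simp_all add: a_def p_def q_def N_def)
  then have mid: "real n * (q - p) = 1 - a"
    by (simp add: right_diff_distrib mult.assoc[symmetric])
  have total: "1 * p + real n * (q - p) + a * (1 - q) = 1"
    unfolding mid using \<open>p = q * a\<close> by (simp add: algebra_simps)
  have a: "0 < a" "a \<le> 1"
    by (simp_all add: a_def)
  define g where "g = three_piece c p q 1 (real n) a"
  have "g \<in> germ_group n"
    using three_piece_in_germ_group[of n p q c 0 0 1 0 0 "-1", unfolded sl slope_zero mid, folded a_def]
      n pq R total[unfolded mid] N a
    by (simp add: g_def c_def p_def)
  moreover have "g (of_int k) \<notin> \<int>" for k
  proof
    assume "g (of_int k) \<in> \<int>"
    then have "c \<in> \<int>"
      using pq Ints_diff[of "of_int k + c" "of_int k"]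
      by (simp add: g_def three_piece_def profile_def)
    moreover have "0 < c" "c < 1"
      using N by (auto simp: c_def)
    ultimately show False
      by (auto elim!: Ints_cases)
  qed
  ultimately show ?thesis
    using that by blast
qed

section \<open>The translation number on the commutator subgroup\<close>

lemma Homeo_plus_simps:
  "f \<otimes>\<^bsub>Homeo_plus\<^esub> g = g \<circ> f" "\<one>\<^bsub>Homeo_plus\<^esub> = id" "f [^]\<^bsub>Homeo_plus\<^esub> (m::nat) = f ^^ m"
proof -
  show mult: "f \<otimes>\<^bsub>Homeo_plus\<^esub> g = g \<circ> f" for f g
    by (simp add: Homeo_plus_def)
  show one: "\<one>\<^bsub>Homeo_plus\<^esub> = id"
    by (simp add: Homeo_plus_def)
  show "f [^]\<^bsub>Homeo_plus\<^esub> (m::nat) = f ^^ m"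
    by (induction m) (simp_all add: mult one)
qed

lemma Homeo_plus_inv:
  assumes "f \<in> carrier Homeo_plus"
  shows "(inv\<^bsub>Homeo_plus\<^esub> f) (f x) = x" "f ((inv\<^bsub>Homeo_plus\<^esub> f) x) = x"
proof -
  interpret group Homeo_plus by (rule group_Homeo_plus)
  show "(inv\<^bsub>Homeo_plus\<^esub> f) (f x) = x" "f ((inv\<^bsub>Homeo_plus\<^esub> f) x) = x"
    using r_inv[OF assms] l_inv[OF assms] by (simp_all add: Homeo_plus_simps fun_eq_iff)
qed

lemma Q_simps:
  "f \<otimes>\<^bsub>Q n\<^esub> g = g \<circ> f" "\<one>\<^bsub>Q n\<^esub> = id" "f [^]\<^bsub>Q n\<^esub> (m::nat) = f ^^ m"
proof -
  show mult: "f \<otimes>\<^bsub>Q n\<^esub> g = g \<circ> f" for f g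
    by (simp add: Q_def Homeo_plus_simps)
  show one: "\<one>\<^bsub>Q n\<^esub> = id"
    by (simp add: Q_def Homeo_plus_simps)
  show "f [^]\<^bsub>Q n\<^esub> (m::nat) = f ^^ m"
    by (induction m) (simp_all add: mult one)
qed

text \<open>The lifts in \<open>Homeo_plus\<close> form a subgroup, so they contain the commutator subgroup of the set
  \<open>Gamma n\<close> of lifts.\<close>

lemma Q_circle_lift:
  assumes "f \<in> carrier (Q n)"
  shows "circle_lift f"
proof -
  interpret group Homeo_plus by (rule group_Homeo_plus)
  define S where "S = {f \<in> carrier Homeo_plus. \<forall>t. f (t + 1) = f t + 1}"
  have "subgroup S Homeo_plus"
  proof (rule subgroupI)
    have "id \<in> S"
      using one_closed by (simp add: S_def Homeo_plus_simps)
    then show "S \<noteq> {}"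
      by blast
    show "inv\<^bsub>Homeo_plus\<^esub> f \<in> S" if "f \<in> S" for f
    proof -
      have f: "f \<in> carrier Homeo_plus" "\<And>t. f (t + 1) = f t + 1"
        using that by (auto simp: S_def)
      have "(inv\<^bsub>Homeo_plus\<^esub> f) (t + 1) = (inv\<^bsub>Homeo_plus\<^esub> f) t + 1" for t
        using f(2)[of "(inv\<^bsub>Homeo_plus\<^esub> f) t"] Homeo_plus_inv[OF f(1)] by metis
      then show ?thesis
        using f(1) by (simp add: S_def)
    qed
    show "f \<otimes>\<^bsub>Homeo_plus\<^esub> g \<in> S" if "f \<in> S" "g \<in> S" for f g
      using that m_closed[of f g] by (simp add: S_def Homeo_plus_simps)
  qed (auto simp: S_def)
  moreover have "Gamma n \<subseteq> S"
    by (auto simp: Gamma_def S_def)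
  ultimately have "f \<in> S"
    using derived_incl assms by (auto simp: Q_def)
  then show ?thesis
    by (auto simp: S_def circle_lift_def Homeo_plus_def strict_mono_mono)
qed

lemma translation_number_quasimorphism: "quasimorphism (Q n) translation_number"
  unfolding quasimorphism_def
proof (rule bdd_aboveI2[where M = 4], clarify)
  fix f g assume "f \<in> carrier (Q n)" "g \<in> carrier (Q n)"
  then show "\<bar>translation_number (f \<otimes>\<^bsub>Q n\<^esub> g) - translation_number f - translation_number g\<bar> \<le> 4"
    unfolding Q_simps by (intro translation_number_quasi Q_circle_lift)
qed

lemma translation_number_homogeneous: "homogeneous_on (Q n) translation_number"
  unfolding homogeneous_on_def
proof (intro ballI allI)
  fix f and k :: int assume f: "f \<in> carrier (Q n)"
  interpret group "Q n" by (rule group_Q)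
  have power: "translation_number (f [^]\<^bsub>Q n\<^esub> m) = real m * translation_number f" for m :: nat
    using translation_number_funpow[OF Q_circle_lift[OF f]] by (simp add: Q_simps)
  have inverse: "translation_number (inv\<^bsub>Q n\<^esub> g) = - translation_number g" if g: "g \<in> carrier (Q n)" for g
  proof -
    have "inv\<^bsub>Q n\<^esub> g \<circ> g = id"
      using r_inv[OF g] by (simp add: Q_simps)
    then show ?thesis
      using translation_number_inverse g Q_circle_lift inv_closed by blast
  qed
  show "translation_number (f [^]\<^bsub>Q n\<^esub> k) = of_int k * translation_number f"
  proof (cases "k < 0")
    case True
    then have "f [^]\<^bsub>Q n\<^esub> k = inv\<^bsub>Q n\<^esub> (f [^]\<^bsub>Q n\<^esub> nat (- k))"
      by (simp only: int_pow_def2 if_True)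
    then have "translation_number (f [^]\<^bsub>Q n\<^esub> k) = - (real (nat (- k)) * translation_number f)"
      by (simp only: inverse[OF nat_pow_closed[OF f]] power)
    then show ?thesis
      using True by simp
  next
    case False
    then have "f [^]\<^bsub>Q n\<^esub> k = f [^]\<^bsub>Q n\<^esub> nat k"
      by (simp only: int_pow_def2 if_False)
    then have "translation_number (f [^]\<^bsub>Q n\<^esub> k) = real (nat k) * translation_number f"
      by (simp only: power)
    then show ?thesis
      using False by simp
  qed
qed

text \<open>A bounded orbit would increase to a fixed point.\<close>

lemma orbit_unbounded:
  fixes X :: "real \<Rightarrow> real"
  assumes cont: "\<And>x. isCont X x" and push: "\<And>x. x < X x"
  shows "\<exists>m. B \<le> (X ^^ m) x"
proof (rule ccontr)
  assume "\<not> (\<exists>m. B \<le> (X ^^ m) x)"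
  then have "(X ^^ m) x \<le> B" for m
    by (meson linear)
  moreover have "incseq (\<lambda>m. (X ^^ m) x)"
    by (rule incseq_SucI) (simp add: push less_imp_le)
  ultimately obtain L where L: "(\<lambda>m. (X ^^ m) x) \<longlonglongrightarrow> L"
    using incseq_convergent by blast
  have "(\<lambda>m. X ((X ^^ m) x)) \<longlonglongrightarrow> X L"
    using cont L by (rule isCont_tendsto_compose)
  moreover have "(\<lambda>m. X ((X ^^ m) x)) \<longlonglongrightarrow> L"
    using LIMSEQ_Suc[OF L] by simp
  ultimately have "X L = L"
    by (rule LIMSEQ_unique)
  then show False
    using push[of L] by simp
qed

lemma exists_nonzero_translation_number:
  assumes n: "n \<ge> 2"
  shows "\<exists>f\<in>carrier (Q n). translation_number f \<noteq> 0"
proof -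
  interpret group Homeo_plus by (rule group_Homeo_plus)
  have n0: "n > 0"
    using n by simp
  obtain h where h: "h \<in> germ_group n" and h_int: "\<And>k. h (of_int k) = of_int k"
    and h_push: "\<And>x. x \<notin> \<int> \<Longrightarrow> x < h x"
    using pushing_element[OF n] by blast
  obtain g where g: "g \<in> germ_group n" and g_int: "\<And>k. g (of_int k) \<notin> \<int>"
    using element_moving_integers_off_integers[OF n] by blast
  note sub = germ_group_subgroup[OF n0]
  have hG: "h \<in> carrier Homeo_plus" and gG: "g \<in> carrier Homeo_plus"
    using subgroup.mem_carrier[OF sub] h g by auto
  let ?i = "inv\<^bsub>Homeo_plus\<^esub> g"
  define k where "k = ?i \<otimes>\<^bsub>Homeo_plus\<^esub> h \<otimes>\<^bsub>Homeo_plus\<^esub> g"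
  define X where "X = h \<otimes>\<^bsub>Homeo_plus\<^esub> k"
  have k_eq: "k x = g (h (?i x))" for x
    by (simp add: k_def Homeo_plus_simps)
  have mono_g: "strict_mono g"
    using gG by (simp add: Homeo_plus_def)
  have h_le: "x \<le> h x" for x
    using h_push[of x] h_int by (cases "x \<in> \<int>") (auto elim: Ints_cases)
  have k_le: "x \<le> k x" for x
    using strict_mono_less_eq[OF mono_g, of "?i x" "h (?i x)"] h_le[of "?i x"]
    by (simp add: k_eq Homeo_plus_inv[OF gG])
  have k_push: "x < k x" if "x \<in> \<int>" for x
  proof -
    have "?i x \<notin> \<int>"
      using g_int that Homeo_plus_inv(2)[OF gG, of x] by (metis Ints_cases)
    then show ?thesis
      using strict_mono_less[OF mono_g, of "?i x" "h (?i x)"] h_push[of "?i x"]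
      by (simp add: k_eq Homeo_plus_inv[OF gG])
  qed
  have X_push: "x < X x" for x
  proof (cases "x \<in> \<int>")
    case True
    then have "h x = x"
      using h_int by (auto elim: Ints_cases)
    then show ?thesis
      using k_push[OF True] by (simp add: X_def Homeo_plus_simps)
  next
    case False
    then show ?thesis
      using h_push[OF False] k_le[of "h x"] by (simp add: X_def Homeo_plus_simps)
  qed
  have XG: "X \<in> carrier Homeo_plus"
    using hG gG by (simp add: X_def k_def)
  then have "isCont X x" for x
    by (auto simp: Homeo_plus_def homeomorphism_def continuous_on_eq_continuous_at)
  \<comment> \<open>Displacement \<open>2\<close> at \<open>0\<close> outweighs the error \<open>1\<close> of the translation number.\<close>
  then obtain m where m: "2 \<le> (X ^^ m) 0"
    using orbit_unbounded[of X 2 0] X_push by blast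
  define f where "f = inv\<^bsub>Homeo_plus\<^esub> (h [^]\<^bsub>Homeo_plus\<^esub> (2 * m)) \<otimes>\<^bsub>Homeo_plus\<^esub> X [^]\<^bsub>Homeo_plus\<^esub> m"
  have "f \<in> derived Homeo_plus (germ_group n)"
    unfolding f_def X_def k_def by (rule conjugate_product_power_in_derived[OF sub h g])
  then have fQ: "f \<in> carrier (Q n)"
    using mono_derived[OF germ_group_subset_Gamma[OF n0]] by (auto simp: Q_def)
  have "(h ^^ l) 0 = 0" for l
    using h_int[of 0] by (induction l) auto
  then have "(inv\<^bsub>Homeo_plus\<^esub> (h [^]\<^bsub>Homeo_plus\<^esub> (2 * m))) 0 = 0"
    using Homeo_plus_inv(1)[OF nat_pow_closed[OF hG], of "2 * m" 0] by (simp add: Homeo_plus_simps)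
  then have "f 0 = (X ^^ m) 0"
    by (simp add: f_def Homeo_plus_simps)
  then have "translation_number f \<ge> 1"
    using translation_number_bound[OF Q_circle_lift[OF fQ]] m by simp
  then show ?thesis
    using fQ by (intro bexI[of _ f]) auto
qed

theorem mainTheorem5:
  fixes n :: nat
  assumes "n \<ge> 2"
  shows "(\<forall>f\<in>carrier (Q n). convergent (\<lambda>m. (f ^^ m) 0 / real m)) \<and>
    quasimorphism (Q n) translation_number \<and>
    homogeneous_on (Q n) translation_number \<and>
    (\<exists>f\<in>carrier (Q n). translation_number f \<noteq> 0) \<and>
    (\<forall>m::nat. \<exists>f\<in>carrier (Q n). \<not> (\<exists>k<m. product_of_commutators (Q n) k f))"
proof (intro conjI)
  show "\<forall>f\<in>carrier (Q n). convergent (\<lambda>m. (f ^^ m) 0 / real m)"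
    by (intro ballI convergentI[OF translation_number_LIMSEQ[OF Q_circle_lift]])
  show nontrivial: "\<exists>f\<in>carrier (Q n). translation_number f \<noteq> 0"
    by (rule exists_nonzero_translation_number[OF assms])
  show "\<forall>m::nat. \<exists>f\<in>carrier (Q n). \<not> (\<exists>k<m. product_of_commutators (Q n) k f)"
    using nontrivial unbounded_commutator_width[OF group_Q translation_number_quasimorphism
        translation_number_homogeneous] by blast
qed (rule translation_number_quasimorphism translation_number_homogeneous)+

end
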